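(* The compact spaces $(\{0,1\}^{\omega\cdot 2+1},\tau_\prec)$ and $([0,1]^2\times\{0,1\},\tau_\prec)$ are not Corson-to-one preimages of metric compacta.
   Context: Here $\omega\cdot 2+1=\omega+\omega+1$ is the ordinal. Each of the products $\{0,1\}^{\omega\cdot 2+1}$ and $[0,1]^2\times\{0,1\}=[0,1]\times[0,1]\times\{0,1\}$ is given the lexicographic order $\prec$ ($x\prec y$ iff $x\neq y$ and $x_\gamma<y_\gamma$ at the first coordinate $\gamma$ where $x_\gamma\neq y_\gamma$), and $\tau_\prec$ denotes the order topology of $\prec$. A compact space $C$ is Corson if it is homeomorphic to a compact subset $C'\subset\mathbb{R}^I$ of some power of the real line such that for every $x,y\in C'$ the set $\{i\in I: x_i\neq y_i\}$ is at most countable. A compact space $K$ is a Corson-to-one preimage of a metric space $M$ if there exists a continuous function $f:K\to M$ onto $M$ such that $f^{-1}(x)$ is a Corson compactum for every $x\in M$. *)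

theory Defs
  imports "HOL-Analysis.Analysis"
begin

definition order_topology_on :: "'a set \<Rightarrow> ('a \<times> 'a) set \<Rightarrow> 'a topology" where
  "order_topology_on S r =
     topology_generated_by
       (insert S ((\<lambda>a. {x \<in> S. (x, a) \<in> r}) ` S \<union> (\<lambda>a. {x \<in> S. (a, x) \<in> r}) ` S))"

lemma topspace_order_topology_on [simp]: "topspace (order_topology_on S r) = S"
  unfolding order_topology_on_def topology_generated_by_topspace by auto

text \<open>The strict lexicographic order on functions, with the coordinates in \<open>I\<close> ordered by the
  strict relation \<open>r\<close>.\<close>

definition lex_fun_rel :: "'i set \<Rightarrow> ('i \<times> 'i) set \<Rightarrow> (('i \<Rightarrow> 'b::linorder) \<times> ('i \<Rightarrow> 'b)) set" where
  "lex_fun_rel I r =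
     {(x, y). \<exists>i\<in>I. x i < y i \<and> (\<forall>j\<in>I. (j, i) \<in> r \<longrightarrow> x j = y j)}"

text \<open>Under the lexicographic order, \<open>nat \<times> nat\<close> is the ordinal \<open>\<omega> \<cdot> \<omega>\<close>, the pair \<open>(m, n)\<close> standing
  for \<open>\<omega> \<cdot> m + n\<close>. The ordinal \<open>\<omega> \<cdot> 2 + 1\<close> is its initial segment below \<open>(2, 1)\<close>, that is,
  all \<open>(0, n)\<close>, then all \<open>(1, n)\<close>, then \<open>(2, 0)\<close>.\<close>

definition omega_sq_less :: "((nat \<times> nat) \<times> (nat \<times> nat)) set" where
  "omega_sq_less = less_than <*lex*> less_than"

definition omega2_plus1 :: "(nat \<times> nat) set" where
  "omega2_plus1 = {p. (p, (2, 1)) \<in> omega_sq_less}"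

lemma omega2_plus1_eq: "omega2_plus1 = {0, 1} \<times> UNIV \<union> {(2, 0)}"
  unfolding omega2_plus1_def omega_sq_less_def by auto

definition cantor_lex :: "((nat \<times> nat) \<Rightarrow> nat) topology" where
  "cantor_lex =
     order_topology_on (omega2_plus1 \<rightarrow>\<^sub>E {0, 1}) (lex_fun_rel omega2_plus1 omega_sq_less)"

definition square_split_lex :: "(real \<times> real \<times> nat) topology" where
  "square_split_lex =
     order_topology_on ({0..1} \<times> {0..1} \<times> {0, 1})
       ({(a, b). a < b} <*lex*> {(a, b). a < b} <*lex*> {(a, b). a < b})"

text \<open>The index set of the power is taken among the subsets of \<open>'a \<Rightarrow> real\<close>, because one cannot
  quantify over types. This loses no generality: see \<open>corson_compactI\<close> below, where the index set
  has an arbitrary type. (Coordinates that agree as functions on the space can be identified.)\<close>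

definition corson_compact :: "'a topology \<Rightarrow> bool" where
  "corson_compact X \<longleftrightarrow>
     (\<exists>(I :: ('a \<Rightarrow> real) set) C.
        compactin (powertop_real I) C \<and>
        (\<forall>x\<in>C. \<forall>y\<in>C. countable {i \<in> I. x i \<noteq> y i}) \<and>
        X homeomorphic_space subtopology (powertop_real I) C)"

lemma corson_compactI:
  fixes X :: "'a topology" and J :: "'i set"
  assumes C: "compactin (powertop_real J) C"
    and ctb: "\<And>x y. x \<in> C \<Longrightarrow> y \<in> C \<Longrightarrow> countable {j \<in> J. x j \<noteq> y j}"
    and hom: "X homeomorphic_space subtopology (powertop_real J) C"
  shows "corson_compact X"
proof -
  obtain h where h: "homeomorphic_map X (subtopology (powertop_real J) C) h"
    using hom homeomorphic_space by blast
  have Csub: "C \<subseteq> topspace (powertop_real J)"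
    using C compactin_subset_topspace by blast
  have himg: "h ` topspace X = C"
    using homeomorphic_imp_surjective_map[OF h] Csub by (simp add: inf.absorb2)
  have hinj: "inj_on h (topspace X)"
    using homeomorphic_imp_injective_map[OF h] .
  have hcont: "continuous_map X (powertop_real J) h"
    using homeomorphic_imp_continuous_map[OF h] continuous_map_into_fulltopology by blast
  have Xcomp: "compact_space X"
    using C hom homeomorphic_compact_space compact_space_subtopology by blast
  define g where "g j = (\<lambda>a. h a j)" for j
  define I where "I = g ` J"
  define e where "e a = restrict (\<lambda>i. i a) I" for a
  have econt: "continuous_map X (powertop_real I) e"
    unfolding continuous_map_componentwise
  proof (intro conjI ballI)
    show "e ` topspace X \<subseteq> extensional I" by (auto simp: e_def)
    fix i assume "i \<in> I"
    then obtain j where j: "j \<in> J" "i = g j" by (auto simp: I_def)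
    have "continuous_map X euclideanreal (\<lambda>a. h a j)"
      using hcont j by (auto simp: continuous_map_componentwise)
    then show "continuous_map X euclideanreal (\<lambda>a. e a i)"
      using j \<open>i \<in> I\<close> by (simp add: e_def g_def)
  qed
  have einj: "inj_on e (topspace X)"
  proof (rule inj_onI)
    fix a b assume ab: "a \<in> topspace X" "b \<in> topspace X" "e a = e b"
    have ext: "h a \<in> extensional J" "h b \<in> extensional J"
      using ab himg Csub by (auto simp: PiE_def)
    have "h a j = h b j" if "j \<in> J" for j
    proof -
      have "g j \<in> I" using that by (simp add: I_def)
      then show ?thesis using fun_cong[OF ab(3), of "g j"] by (simp add: e_def g_def)
    qed
    then have "h a = h b" using ext by (intro extensionalityI) auto
    then show "a = b" using hinj ab by (auto dest: inj_onD)
  qed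
  let ?C = "e ` topspace X"
  have Ccomp: "compactin (powertop_real I) ?C"
    using image_compactin[OF _ econt] Xcomp by (simp add: compact_space_def)
  have haus: "Hausdorff_space (subtopology (powertop_real I) ?C)"
    by (intro Hausdorff_space_subtopology) (simp add: Hausdorff_space_product_topology)
  have "homeomorphic_map X (subtopology (powertop_real I) ?C) e"
  proof (rule continuous_imp_homeomorphic_map[OF _ Xcomp haus])
    show "continuous_map X (subtopology (powertop_real I) ?C) e"
      using econt by (simp add: continuous_map_in_subtopology)
    show "e ` topspace X = topspace (subtopology (powertop_real I) ?C)"
      using compactin_subset_topspace[OF Ccomp] by (simp add: inf.absorb2)
  qed (rule einj)
  then have "X homeomorphic_space subtopology (powertop_real I) ?C"
    using homeomorphic_space by blast
  moreover have "countable {i \<in> I. e a i \<noteq> e b i}"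
    if "a \<in> topspace X" "b \<in> topspace X" for a b
  proof (rule countable_subset)
    show "{i \<in> I. e a i \<noteq> e b i} \<subseteq> g ` {j \<in> J. h a j \<noteq> h b j}"
      by (auto simp: e_def I_def g_def)
    show "countable (g ` {j \<in> J. h a j \<noteq> h b j})"
      using ctb that himg by (intro countable_image) blast
  qed
  ultimately show ?thesis
    unfolding corson_compact_def using Ccomp by blast
qed

text \<open>The second argument is any metrizable topology. Compactness of \<open>K\<close> is deliberately not a
  conjunct, so that the negation of this predicate cannot hold by lack of compactness.\<close>

definition corson_to_one_preimage :: "'a topology \<Rightarrow> 'm topology \<Rightarrow> bool" where
  "corson_to_one_preimage K M \<longleftrightarrow>
     metrizable_space M \<and>
     (\<exists>f. continuous_map K M f \<and> f ` topspace K = topspace M \<and>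
          (\<forall>x \<in> topspace M. corson_compact (subtopology K {y \<in> topspace K. f y = x})))"

end

theory Submission
  imports Defs
begin

text \<open>
  Both spaces are lexicographic products of the shape \<open>P \<times> Q \<times> {0, 1}\<close> with \<open>P\<close> uncountable: the
  square by definition, and the lexicographic power because a \<open>0\<close>-\<open>1\<close> sequence of length
  \<open>\<omega> \<cdot> 2 + 1\<close> consists of two sequences of length \<open>\<omega>\<close> and a last bit. The obstruction comes from
  one principle, used at two levels: if pairwise separated subsets of a compact ordered space are
  given, then a continuous map to a metrizable space is constant on all but countably many of them
  (\<open>countable_nonconstant_blocks\<close>). Indeed, for each \<open>e > 0\<close> finitely many order-convex open sets on
  which the map oscillates by less than \<open>e\<close> cover the space, and each of them can be responsible
  for at most one set on which the map oscillates by \<open>e\<close> or more.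

  Let \<open>f\<close> map the whole space continuously to a metrizable space. By the principle, applied to the
  blocks \<open>{s} \<times> Q \<times> {0, 1}\<close>, some block lies in a single fibre \<open>F\<close> of \<open>f\<close>. A block is a version of
  the split interval: it has a countable subset \<open>D\<close> whose closure contains uncountably many of the
  jumps \<open>(s, t, 0)\<close>, \<open>(s, t, 1)\<close>. Suppose that \<open>F\<close> is Corson, embedded in a power of the line. Only
  countably many coordinates distinguish points of \<open>D\<close>, so by continuity only these coordinates
  distinguish points of its closure. By the principle again, each of these coordinates separates
  only countably many of the jumps, so the two ends of some jump are separated by none, which
  contradicts the injectivity of the embedding (\<open>corson_countable_jumps\<close>, \<open>not_corson_to_one_preimage\<close>).

  Compactness holds because both orders are complete: among the rays of a cover, the supremum of the
  end points of the lower rays lies in an upper ray, which together with one of the lower rays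
  already covers the space (\<open>compact_space_order_topology\<close>).
\<close>

section \<open>Strict linear orders and their order topologies\<close>

locale strictly_ordered_set =
  fixes S :: "'a set" and r :: "('a \<times> 'a) set"
  assumes irrefl: "x \<in> S \<Longrightarrow> (x, x) \<notin> r"
    and trans: "\<lbrakk>x \<in> S; y \<in> S; z \<in> S; (x, y) \<in> r; (y, z) \<in> r\<rbrakk> \<Longrightarrow> (x, z) \<in> r"
    and total: "\<lbrakk>x \<in> S; y \<in> S; x \<noteq> y\<rbrakk> \<Longrightarrow> (x, y) \<in> r \<or> (y, x) \<in> r"
begin

definition order_convex :: "'a set \<Rightarrow> bool" where
  "order_convex V \<longleftrightarrow>
     (\<forall>a\<in>V. \<forall>c\<in>V. \<forall>b\<in>S. (a, b) \<in> r \<and> (b, c) \<in> r \<longrightarrow> b \<in> V)"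

definition separated :: "'i set \<Rightarrow> ('i \<Rightarrow> 'a set) \<Rightarrow> bool" where
  "separated T B \<longleftrightarrow>
     (\<forall>s\<in>T. \<forall>t\<in>T. s \<noteq> t \<longrightarrow>
        (\<forall>x\<in>B s. \<forall>y\<in>B t. (x, y) \<in> r) \<or> (\<forall>x\<in>B s. \<forall>y\<in>B t. (y, x) \<in> r))"

lemma separatedI:
  fixes less :: "'i \<Rightarrow> 'i \<Rightarrow> bool"
  assumes "\<And>s t. \<lbrakk>s \<in> T; t \<in> T; s \<noteq> t\<rbrakk> \<Longrightarrow> less s t \<or> less t s"
    and "\<And>s t x y. \<lbrakk>s \<in> T; t \<in> T; less s t; x \<in> B s; y \<in> B t\<rbrakk> \<Longrightarrow> (x, y) \<in> r"
  shows "separated T B"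
  unfolding separated_def
proof (intro ballI impI)
  fix s t assume st: "s \<in> T" "t \<in> T" "s \<noteq> t"
  show "(\<forall>x\<in>B s. \<forall>y\<in>B t. (x, y) \<in> r) \<or> (\<forall>x\<in>B s. \<forall>y\<in>B t. (y, x) \<in> r)"
    using assms(1)[OF st] assms(2)[OF st(1,2)] assms(2)[OF st(2,1)] by (elim disjE) simp_all
qed

lemma strictly_ordered_set_converse: "strictly_ordered_set S (r\<inverse>)"
proof
  show "(x, x) \<notin> r\<inverse>" if "x \<in> S" for x using irrefl[OF that] by simp
  show "(x, z) \<in> r\<inverse>"
    if "x \<in> S" "y \<in> S" "z \<in> S" "(x, y) \<in> r\<inverse>" "(y, z) \<in> r\<inverse>" for x y z
    using trans[of z y x] that by simp
  show "(x, y) \<in> r\<inverse> \<or> (y, x) \<in> r\<inverse>" if "x \<in> S" "y \<in> S" "x \<noteq> y" for x y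
    using total[OF that] by auto
qed

lemma open_generated:
  "openin (order_topology_on S r) U \<Longrightarrow>
     generate_topology_on
       (insert S ((\<lambda>a. {x \<in> S. (x, a) \<in> r}) ` S \<union> (\<lambda>a. {x \<in> S. (a, x) \<in> r}) ` S)) U"
  unfolding order_topology_on_def by (rule openin_topology_generated_by)

text \<open>Rays are order-convex, and order-convex sets are closed under intersections.\<close>

lemma order_convex_neighbourhood:
  assumes "openin (order_topology_on S r) U" "p \<in> U"
  obtains V where "openin (order_topology_on S r) V" "order_convex V" "p \<in> V" "V \<subseteq> U"
proof -
  have "\<forall>p\<in>U. \<exists>V. openin (order_topology_on S r) V \<and> order_convex V \<and> p \<in> V \<and> V \<subseteq> U"
    using open_generated[OF assms(1)]
  proof induction
    case Empty
    then show ?case by simp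
  next
    case (Int a b)
    show ?case
    proof
      fix p assume p: "p \<in> a \<inter> b"
      obtain V where V: "openin (order_topology_on S r) V" "order_convex V" "p \<in> V" "V \<subseteq> a"
        using Int.IH(1) p by blast
      obtain W where W: "openin (order_topology_on S r) W" "order_convex W" "p \<in> W" "W \<subseteq> b"
        using Int.IH(2) p by blast
      have "order_convex (V \<inter> W)"
        using V(2) W(2) unfolding order_convex_def by blast
      then show "\<exists>V. openin (order_topology_on S r) V \<and> order_convex V \<and> p \<in> V \<and> V \<subseteq> a \<inter> b"
        using V W by (intro exI[of _ "V \<inter> W"]) auto
    qed
  next
    case (UN K)
    show ?case
    proof
      fix p assume "p \<in> \<Union>K"
      then obtain k where k: "k \<in> K" "p \<in> k" by blast
      then obtain V where "openin (order_topology_on S r) V" "order_convex V" "p \<in> V" "V \<subseteq> k"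
        using UN.IH[OF k(1)] by blast
      then show "\<exists>V. openin (order_topology_on S r) V \<and> order_convex V \<and> p \<in> V \<and> V \<subseteq> \<Union>K"
        using k(1) by blast
    qed
  next
    case (Basis s)
    have "openin (order_topology_on S r) s"
      unfolding order_topology_on_def using Basis by (rule topology_generated_by_Basis)
    moreover have "order_convex s"
      unfolding order_convex_def
    proof (intro ballI impI)
      fix a c b assume *: "a \<in> s" "c \<in> s" "b \<in> S" "(a, b) \<in> r \<and> (b, c) \<in> r"
      consider "s = S" | e where "e \<in> S" "s = {x \<in> S. (x, e) \<in> r}"
        | e where "e \<in> S" "s = {x \<in> S. (e, x) \<in> r}"
        using Basis by blast
      then show "b \<in> s"
      proof cases
        case 2
        then show ?thesis using * trans[of b c e] by simp
      next
        case 3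
        then show ?thesis using * trans[of e a b] by simp
      qed (use * in simp)
    qed
    ultimately show ?case by blast
  qed
  then show thesis using assms(2) that by blast
qed

text \<open>At a point that is not the least one, a finite intersection of rays contains a half-open
  interval to the left. The one-sided form matters because the left end of a jump can be approached
  only from the left.\<close>

lemma interval_below_in_open:
  assumes U: "openin (order_topology_on S r) U" "p \<in> U" and p: "p \<in> S" "a0 \<in> S" "(a0, p) \<in> r"
  obtains a where "a \<in> S" "(a, p) \<in> r"
    "\<And>x. \<lbrakk>x \<in> S; (a, x) \<in> r; x = p \<or> (x, p) \<in> r\<rbrakk> \<Longrightarrow> x \<in> U"
proof -
  have "p \<in> U \<longrightarrow>
      (\<exists>a\<in>S. (a, p) \<in> r \<and> (\<forall>x\<in>S. (a, x) \<in> r \<and> (x = p \<or> (x, p) \<in> r) \<longrightarrow> x \<in> U))"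
    using open_generated[OF U(1)]
  proof induction
    case Empty
    then show ?case by simp
  next
    case (Int U1 U2)
    show ?case
    proof
      assume "p \<in> U1 \<inter> U2"
      then obtain a b where
        a: "a \<in> S" "(a, p) \<in> r" "\<forall>x\<in>S. (a, x) \<in> r \<and> (x = p \<or> (x, p) \<in> r) \<longrightarrow> x \<in> U1" and
        b: "b \<in> S" "(b, p) \<in> r" "\<forall>x\<in>S. (b, x) \<in> r \<and> (x = p \<or> (x, p) \<in> r) \<longrightarrow> x \<in> U2"
        using Int.IH by blast
      consider "a = b" | "(a, b) \<in> r" | "(b, a) \<in> r" using total a(1) b(1) by blast
      then show "\<exists>a\<in>S. (a, p) \<in> r \<and>
          (\<forall>x\<in>S. (a, x) \<in> r \<and> (x = p \<or> (x, p) \<in> r) \<longrightarrow> x \<in> U1 \<inter> U2)"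
      proof cases
        case 1
        then show ?thesis using a b by blast
      next
        case 2
        then show ?thesis using a b trans[of a b] by blast
      next
        case 3
        then show ?thesis using a b trans[of b a] by blast
      qed
    qed
  next
    case (UN K)
    show ?case
    proof
      assume "p \<in> \<Union>K"
      then obtain k where k: "k \<in> K" "p \<in> k" by blast
      then obtain a where "a \<in> S" "(a, p) \<in> r"
          "\<forall>x\<in>S. (a, x) \<in> r \<and> (x = p \<or> (x, p) \<in> r) \<longrightarrow> x \<in> k"
        using UN.IH[OF k(1)] by blast
      then show "\<exists>a\<in>S. (a, p) \<in> r \<and>
          (\<forall>x\<in>S. (a, x) \<in> r \<and> (x = p \<or> (x, p) \<in> r) \<longrightarrow> x \<in> \<Union>K)"
        using k(1) by blast
    qed
  next
    case (Basis s)
    show ?case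
    proof
      assume ps: "p \<in> s"
      consider "s = S" | b where "b \<in> S" "s = {x \<in> S. (x, b) \<in> r}"
        | b where "b \<in> S" "s = {x \<in> S. (b, x) \<in> r}"
        using Basis by blast
      then show "\<exists>a\<in>S. (a, p) \<in> r \<and>
          (\<forall>x\<in>S. (a, x) \<in> r \<and> (x = p \<or> (x, p) \<in> r) \<longrightarrow> x \<in> s)"
      proof cases
        case 1
        then show ?thesis using p by blast
      next
        case 2
        then show ?thesis using p ps trans[of _ p b] by blast
      next
        case 3
        then show ?thesis using ps by blast
      qed
    qed
  qed
  then show thesis using U(2) that by blast
qed

lemma closure_of_from_below:
  assumes "p \<in> S" "a0 \<in> S" "(a0, p) \<in> r" "D \<subseteq> S"
    and "\<And>a. \<lbrakk>a \<in> S; (a, p) \<in> r\<rbrakk> \<Longrightarrow> \<exists>d\<in>D. (a, d) \<in> r \<and> (d = p \<or> (d, p) \<in> r)"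
  shows "p \<in> order_topology_on S r closure_of D"
  unfolding in_closure_of
proof (intro conjI allI impI; (elim conjE)?)
  show "p \<in> topspace (order_topology_on S r)" using assms by simp
  fix U assume "p \<in> U" "openin (order_topology_on S r) U"
  then obtain a where "a \<in> S" "(a, p) \<in> r"
      "\<And>x. \<lbrakk>x \<in> S; (a, x) \<in> r; x = p \<or> (x, p) \<in> r\<rbrakk> \<Longrightarrow> x \<in> U"
    using interval_below_in_open assms(1-3) by metis
  then show "\<exists>d. d \<in> D \<and> d \<in> U" using assms(4,5) by blast
qed

end

text \<open>Reversing the order exchanges lower and upper rays; statements about approximation from above
  follow from those about approximation from below.\<close>

lemma order_topology_on_converse: "order_topology_on S (r\<inverse>) = order_topology_on S r"
  unfolding order_topology_on_def by (simp add: Un_commute)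

lemma (in strictly_ordered_set) closure_of_from_above:
  assumes "p \<in> S" "a0 \<in> S" "(p, a0) \<in> r" "D \<subseteq> S"
    and "\<And>a. \<lbrakk>a \<in> S; (p, a) \<in> r\<rbrakk> \<Longrightarrow> \<exists>d\<in>D. (d, a) \<in> r \<and> (d = p \<or> (p, d) \<in> r)"
  shows "p \<in> order_topology_on S r closure_of D"
proof -
  interpret converse: strictly_ordered_set S "r\<inverse>" by (rule strictly_ordered_set_converse)
  show ?thesis
    using converse.closure_of_from_below[of p a0 D] assms
    by (simp add: order_topology_on_converse)
qed

section \<open>Compactness of complete orders\<close>

text \<open>Every subset \<open>A\<close> has a supremum \<open>s\<close>, expressed by the strict order alone: no element of \<open>A\<close>
  exceeds \<open>s\<close>, and whatever lies below \<open>s\<close> is exceeded by an element of \<open>A\<close>. The case \<open>A = {}\<close>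
  provides a least element.\<close>

definition order_complete :: "'a set \<Rightarrow> ('a \<times> 'a) set \<Rightarrow> bool" where
  "order_complete S r \<longleftrightarrow>
     (\<forall>A\<subseteq>S. \<exists>s\<in>S. (\<forall>a\<in>A. (s, a) \<notin> r) \<and> (\<forall>b\<in>S. (b, s) \<in> r \<longrightarrow> (\<exists>a\<in>A. (b, a) \<in> r)))"

lemma order_completeD:
  assumes "order_complete S r" "A \<subseteq> S"
  obtains s where "s \<in> S" "\<forall>a\<in>A. (s, a) \<notin> r"
    "\<forall>b\<in>S. (b, s) \<in> r \<longrightarrow> (\<exists>a\<in>A. (b, a) \<in> r)"
  using assms unfolding order_complete_def by blast

text \<open>This identifies the topology generated by a subbase that contains its own union with the
  form in which the Alexander subbase theorem expects it; the whole space then makes every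
  intersection one of nonempty families.\<close>

lemma topology_generated_by_subbase:
  assumes "\<Union>\<B> \<in> \<B>"
  shows "topology (arbitrary union_of (finite intersection_of (\<lambda>x. x \<in> \<B>) relative_to \<Union>\<B>))
           = topology_generated_by \<B>"
proof -
  have "(finite intersection_of (\<lambda>x. x \<in> \<B>) relative_to \<Union>\<B>) =
        (finite' intersection_of (\<lambda>x. x \<in> \<B>))"
  proof (intro ext iffI)
    fix A assume "(finite intersection_of (\<lambda>x. x \<in> \<B>) relative_to \<Union>\<B>) A"
    then obtain \<F> where "finite \<F>" "\<F> \<subseteq> \<B>" "A = \<Union>\<B> \<inter> \<Inter>\<F>"
      unfolding relative_to_def intersection_of_def by auto
    then show "(finite' intersection_of (\<lambda>x. x \<in> \<B>)) A"
      unfolding intersection_of_def using assms by (intro exI[of _ "insert (\<Union>\<B>) \<F>"]) auto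
  next
    fix A assume "(finite' intersection_of (\<lambda>x. x \<in> \<B>)) A"
    then obtain \<F> where F: "finite \<F>" "\<F> \<noteq> {}" "\<F> \<subseteq> \<B>" "A = \<Inter>\<F>"
      unfolding intersection_of_def by auto
    then have "A = \<Union>\<B> \<inter> \<Inter>\<F>" by blast
    then show "(finite intersection_of (\<lambda>x. x \<in> \<B>) relative_to \<Union>\<B>) A"
      unfolding relative_to_def intersection_of_def using F(1,3)
      by (intro exI[of _ "\<Inter>\<F>"] conjI exI[of _ \<F>]) auto
  qed
  then show ?thesis by (simp add: generate_topology_on_eq)
qed

text \<open>By the Alexander subbase theorem it is enough to treat covers by rays. The supremum of the end
  points of the lower rays of such a cover is in an upper ray \<open>(b, \<rightarrow>)\<close>; by the choice of the
  supremum some lower ray \<open>(\<leftarrow>, a)\<close> has \<open>b < a\<close>, and these two rays cover everything.\<close>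

lemma (in strictly_ordered_set) compact_space_order_topology:
  assumes "order_complete S r"
  shows "compact_space (order_topology_on S r)"
proof -
  define lower where "lower a = {x \<in> S. (x, a) \<in> r}" for a
  define upper where "upper a = {x \<in> S. (a, x) \<in> r}" for a
  define \<B> where "\<B> = insert S (lower ` S \<union> upper ` S)"
  have UB: "\<Union>\<B> = S" by (auto simp: \<B>_def lower_def upper_def)
  have X: "order_topology_on S r = topology_generated_by \<B>"
    by (simp add: order_topology_on_def \<B>_def lower_def upper_def)
  show ?thesis
  proof (rule Alexander_subbase[of \<B>])
    have "\<Union>\<B> \<in> \<B>" unfolding UB by (simp add: \<B>_def)
    then show "topology (arbitrary union_of (finite intersection_of (\<lambda>x. x \<in> \<B>) relative_to \<Union>\<B>))
        = order_topology_on S r"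
      by (simp only: X topology_generated_by_subbase)
  next
    fix \<C> assume \<C>: "\<C> \<subseteq> \<B>" "\<Union>\<C> = topspace (order_topology_on S r)"
    then have cover: "\<Union>\<C> = S" by simp
    have "\<exists>\<F>. finite \<F> \<and> \<F> \<subseteq> \<C> \<and> S \<subseteq> \<Union>\<F>"
    proof (cases "S \<in> \<C>")
      case True
      then show ?thesis by (intro exI[of _ "{S}"]) auto
    next
      case False
      define A where "A = {a \<in> S. lower a \<in> \<C>}"
      have "A \<subseteq> S" by (auto simp: A_def)
      then obtain s where s: "s \<in> S" "\<forall>a\<in>A. (s, a) \<notin> r"
          "\<forall>b\<in>S. (b, s) \<in> r \<longrightarrow> (\<exists>a\<in>A. (b, a) \<in> r)"
        by (rule order_completeD[OF assms])
      obtain U where U: "U \<in> \<C>" "s \<in> U" using cover s(1) by blast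
      (* the supremum of the right ends of the lower rays lies in no lower ray *)
      obtain b where b: "b \<in> S" "U = upper b" "(b, s) \<in> r"
        using U \<C>(1) False s(1,2) by (auto simp: \<B>_def lower_def upper_def A_def)
      obtain a where a: "a \<in> A" "(b, a) \<in> r" using s(3) b by blast
      have "x \<in> lower a \<or> x \<in> upper b" if "x \<in> S" for x
        using that total[of x a] trans[of b a x] a b(1)
        by (auto simp: A_def lower_def upper_def)
      then have "S \<subseteq> \<Union>{lower a, upper b}" by auto
      moreover have "{lower a, upper b} \<subseteq> \<C>" using a b U by (auto simp: A_def)
      ultimately show ?thesis by (meson finite.emptyI finite.insertI)
    qed
    then show "\<exists>\<F>. finite \<F> \<and> \<F> \<subseteq> \<C> \<and> \<Union>\<F> = topspace (order_topology_on S r)"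
      using cover by (metis Union_mono subset_antisym topspace_order_topology_on)
  qed
qed

section \<open>Continuous maps to metrizable spaces\<close>

text \<open>For \<open>e > 0\<close>, cover \<open>K\<close> by finitely many order-convex open sets \<open>V\<close> on which \<open>f\<close> oscillates by
  less than \<open>e\<close>. If \<open>f\<close> oscillates by \<open>e\<close> or more on \<open>B t\<close>, then there are points \<open>a\<close> before \<open>b\<close> in
  \<open>B t\<close> and a set \<open>V\<close> of the cover with \<open>a \<in> V\<close> and \<open>b \<notin> V\<close>. By convexity all of \<open>V\<close> then lies
  before \<open>b\<close>, hence no later block meets \<open>V\<close>. So each \<open>V\<close> accounts for at most one block, only
  finitely many blocks have oscillation \<open>e\<close> or more, and \<open>e\<close> may run through \<open>1 / n\<close>.\<close>

lemma (in strictly_ordered_set) countable_nonconstant_blocks: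
  assumes K: "compactin (order_topology_on S r) K"
    and f: "continuous_map (subtopology (order_topology_on S r) K) Y f"
    and Y: "metrizable_space Y"
    and BK: "\<And>t. t \<in> T \<Longrightarrow> B t \<subseteq> K"
    and sep: "separated T B"
  shows "countable {t \<in> T. \<exists>a\<in>B t. \<exists>b\<in>B t. f a \<noteq> f b}"
proof -
  let ?X = "order_topology_on S r"
  obtain M d where M: "Metric_space M d" and YM: "Y = Metric_space.mtopology M d"
    using Y metrizable_space_def by blast
  interpret Metric_space M d by (rule M)
  have KS: "K \<subseteq> S" using compactin_subset_topspace[OF K] by simp
  have fM: "f x \<in> M" if "x \<in> K" for x
    using f that KS unfolding continuous_map_def YM by (auto simp: Pi_iff)
  define jumps where "jumps e = {t \<in> T. \<exists>a\<in>B t. \<exists>b\<in>B t. e \<le> d (f a) (f b)}" for e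
  have "finite (jumps e)" if "e > 0" for e
  proof -
    define small where
      "small V \<longleftrightarrow> openin ?X V \<and> order_convex V \<and> (\<forall>x\<in>V \<inter> K. \<forall>y\<in>V \<inter> K. d (f x) (f y) < e)" for V
    have "\<exists>V. small V \<and> p \<in> V" if p: "p \<in> K" for p
    proof -
      have "openin (subtopology ?X K) {x \<in> topspace (subtopology ?X K). f x \<in> mball (f p) (e / 2)}"
        using f unfolding YM by (rule openin_continuous_map_preimage) simp
      then obtain U where U: "openin ?X U"
          "{x \<in> topspace (subtopology ?X K). f x \<in> mball (f p) (e / 2)} = U \<inter> K"
        unfolding openin_subtopology by auto
      have "p \<in> U \<inter> K" unfolding U(2)[symmetric] using p KS fM \<open>e > 0\<close> by auto
      then obtain V where V: "openin ?X V" "order_convex V" "p \<in> V" "V \<subseteq> U"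
        using order_convex_neighbourhood[OF U(1)] by blast
      have ball: "f x \<in> mball (f p) (e / 2)" if "x \<in> V \<inter> K" for x
        using that V(4) U(2) by blast
      have "d (f x) (f y) < e" if "x \<in> V \<inter> K" "y \<in> V \<inter> K" for x y
        using ball[OF that(1)] ball[OF that(2)] triangle[of "f x" "f p" "f y"] commute[of "f x" "f p"]
        by auto
      then show ?thesis using V unfolding small_def by blast
    qed
    then have "K \<subseteq> \<Union>(Collect small)" by blast
    moreover have "\<forall>V\<in>Collect small. openin ?X V" by (simp add: small_def)
    ultimately obtain \<V> where \<V>: "finite \<V>" "\<V> \<subseteq> Collect small" "K \<subseteq> \<Union>\<V>"
      using K unfolding compactin_def by meson
    (* the blocks that leave V to the right, each accounted for by V *)
    define left where
      "left V = {t \<in> T. \<exists>a\<in>B t. \<exists>b\<in>B t. (a, b) \<in> r \<and> a \<in> V \<and> b \<notin> V}" for V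
    have "jumps e \<subseteq> (\<Union>V\<in>\<V>. left V)"
    proof
      fix t assume "t \<in> jumps e"
      then obtain a b where t: "t \<in> T" "a \<in> B t" "b \<in> B t" "e \<le> d (f a) (f b)"
        by (auto simp: jumps_def)
      have ab: "a \<in> K" "b \<in> K" using t BK by blast+
      have "a \<noteq> b" using t(4) \<open>e > 0\<close> fM[OF ab(1)] by auto
      then obtain a' b' where ab': "a' \<in> B t" "b' \<in> B t" "a' \<in> K" "b' \<in> K" "(a', b') \<in> r"
          "e \<le> d (f a') (f b')"
        using total[of a b] t ab KS commute by (metis subsetD)
      obtain V where "V \<in> \<V>" "a' \<in> V" using \<V>(3) ab'(3) by blast
      moreover have "b' \<notin> V"
        using calculation \<V>(2) ab' unfolding small_def by force
      ultimately show "t \<in> (\<Union>V\<in>\<V>. left V)" using t(1) ab' by (auto simp: left_def)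
    qed
    moreover have "finite (left V)" if "V \<in> \<V>" for V
    proof -
      have conv: "order_convex V" using that \<V>(2) by (auto simp: small_def)
      (* of two blocks counted by left V, the earlier one would lie between two points of V *)
      have "s = t" if st: "s \<in> left V" "t \<in> left V" for s t
      proof (rule ccontr)
        assume "s \<noteq> t"
        obtain a b where s: "s \<in> T" "a \<in> B s" "b \<in> B s" "(a, b) \<in> r" "a \<in> V" "b \<notin> V"
          using st(1) by (auto simp: left_def)
        obtain a' b' where t: "t \<in> T" "a' \<in> B t" "b' \<in> B t" "(a', b') \<in> r" "a' \<in> V" "b' \<notin> V"
          using st(2) by (auto simp: left_def)
        have "(b, a') \<in> r \<or> (b', a) \<in> r"
          using sep \<open>s \<noteq> t\<close> s t unfolding separated_def by blast
        then show False
          using conv s t BK KS unfolding order_convex_def by (meson subsetD)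
      qed
      then have "left V \<subseteq> {t} \<or> left V = {}" if "t \<in> left V" for t using that by blast
      then show ?thesis by (metis finite.emptyI finite.insertI finite_subset ex_in_conv)
    qed
    ultimately show ?thesis using \<V>(1) by (meson finite_UN finite_subset)
  qed
  then have "countable (jumps (1 / real (Suc n)))" for n
    by (simp add: countable_finite)
  then have "countable (\<Union>n. jumps (1 / real (Suc n)))" by simp
  moreover have "{t \<in> T. \<exists>a\<in>B t. \<exists>b\<in>B t. f a \<noteq> f b} \<subseteq> (\<Union>n. jumps (1 / real (Suc n)))"
  proof
    fix t assume "t \<in> {t \<in> T. \<exists>a\<in>B t. \<exists>b\<in>B t. f a \<noteq> f b}"
    then obtain a b where t: "t \<in> T" "a \<in> B t" "b \<in> B t" "f a \<noteq> f b" by blast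
    have "d (f a) (f b) > 0" using t BK fM mdist_pos_less by blast
    then obtain n where "1 / real (Suc n) < d (f a) (f b)"
      using nat_approx_posE by blast
    then have "t \<in> jumps (1 / real (Suc n))"
      using t less_imp_le unfolding jumps_def by blast
    then show "t \<in> (\<Union>n. jumps (1 / real (Suc n)))" by blast
  qed
  ultimately show ?thesis by (rule countable_subset[rotated])
qed

section \<open>Corson compacta\<close>

lemma continuous_map_const_on_closure:
  assumes g: "continuous_map (subtopology X F) Y g" and Y: "Hausdorff_space Y"
    and D: "D \<subseteq> F" and const: "\<And>x. x \<in> D \<Longrightarrow> g x = c" and p: "p \<in> F" "p \<in> X closure_of D"
  shows "g p = c"
proof -
  have "p \<in> subtopology X F closure_of D"
    using p D unfolding closure_of_subtopology by (simp add: inf.absorb2)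
  then have gp: "g p \<in> Y closure_of (g ` D)"
    using continuous_map_image_closure_subset[OF g, of D] by blast
  have "D \<noteq> {}" using p(2) by auto
  then have gD: "g ` D = {c}" using const by force
  have "c \<in> topspace Y"
  proof (rule ccontr)
    assume "c \<notin> topspace Y"
    then have "topspace Y \<inter> {c} = {}" by blast
    then have "Y closure_of {c} = {}" by (metis closure_of_restrict closure_of_empty)
    then show False using gp gD by simp
  qed
  then have "Y closure_of {c} = {c}"
    using Y by (simp add: closure_of_closedin closedin_Hausdorff_singleton)
  then show ?thesis using gp gD by simp
qed

text \<open>A separable Corson compactum is metrizable, so it cannot contain uncountably many jumps; here
  this is carried out for the part of \<open>F\<close> that is in the closure of \<open>D\<close>. Outside the countable set
  \<open>J\<close> of coordinates that vary on \<open>D\<close>, the embedding is constant on that closure. Each coordinate in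
  \<open>J\<close> is a continuous real function on \<open>F\<close>, so it separates only countably many of the
  pairs. As each pair is separated by some coordinate, there are only countably many pairs.\<close>

lemma (in strictly_ordered_set) corson_countable_jumps:
  assumes F: "compactin (order_topology_on S r) F"
    and C: "corson_compact (subtopology (order_topology_on S r) F)"
    and D: "countable D" "D \<subseteq> F"
    and uv: "\<And>t. t \<in> Q \<Longrightarrow> {u t, v t} \<subseteq> F \<inter> (order_topology_on S r closure_of D)"
    and neq: "\<And>t. t \<in> Q \<Longrightarrow> u t \<noteq> v t"
    and sep: "separated Q (\<lambda>t. {u t, v t})"
  shows "countable Q"
proof -
  let ?X = "order_topology_on S r"
  obtain I :: "('a \<Rightarrow> real) set" and C' where
    I: "compactin (powertop_real I) C'" "\<forall>x\<in>C'. \<forall>y\<in>C'. countable {i \<in> I. x i \<noteq> y i}"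
      "subtopology ?X F homeomorphic_space subtopology (powertop_real I) C'"
    using C unfolding corson_compact_def by (elim exE conjE) rule
  have C': "C' \<subseteq> topspace (powertop_real I)" using I(1) by (rule compactin_subset_topspace)
  obtain h where h: "homeomorphic_map (subtopology ?X F) (subtopology (powertop_real I) C') h"
    using I(3) unfolding homeomorphic_space by (elim exE)
  have tF: "topspace (subtopology ?X F) = F"
    using compactin_subset_topspace[OF F] by (simp add: inf.absorb2)
  have hC: "h ` F = C'"
    using homeomorphic_imp_surjective_map[OF h] tF C' by (simp add: inf.absorb2)
  have hinj: "inj_on h F" using homeomorphic_imp_injective_map[OF h] tF by simp
  have hcont: "continuous_map (subtopology ?X F) euclideanreal (\<lambda>x. h x i)" if "i \<in> I" for i
    using homeomorphic_imp_continuous_map[OF h] that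
    by (auto simp: continuous_map_in_subtopology continuous_map_componentwise)
  define J where "J = (\<Union>d\<in>D. \<Union>d'\<in>D. {i \<in> I. h d i \<noteq> h d' i})"
  have "countable J" unfolding J_def using D I(2) hC by (intro countable_UN) blast+
  have outside: "h (u t) i = h (v t) i" if t: "t \<in> Q" and i: "i \<in> I - J" for t i
  proof -
    have "u t \<in> order_topology_on S r closure_of D" using uv[OF t] by blast
    then have "D \<noteq> {}" by auto
    then obtain d where "d \<in> D" by blast
    have "h x i = h d i" if "x \<in> {u t, v t}" for x
    proof (rule continuous_map_const_on_closure[OF hcont Hausdorff_space_euclidean D(2)])
      show "i \<in> I" using i by blast
      show "h d' i = h d i" if "d' \<in> D" for d'
      proof (rule ccontr)
        assume "h d' i \<noteq> h d i"
        then have "i \<in> J" unfolding J_def using that \<open>d \<in> D\<close> i by blast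
        then show False using i by blast
      qed
      show "x \<in> F" "x \<in> ?X closure_of D" using uv[OF t] that by blast+
    qed
    then show ?thesis by auto
  qed
  have "countable {t \<in> Q. \<exists>a\<in>{u t, v t}. \<exists>b\<in>{u t, v t}. h a i \<noteq> h b i}" if "i \<in> J" for i
  proof (rule countable_nonconstant_blocks[OF F hcont metrizable_space_euclidean _ sep])
    show "i \<in> I" using that by (auto simp: J_def)
  qed (use uv in auto)
  then have "countable (\<Union>i\<in>J. {t \<in> Q. \<exists>a\<in>{u t, v t}. \<exists>b\<in>{u t, v t}. h a i \<noteq> h b i})"
    using \<open>countable J\<close> by (intro countable_UN)
  moreover have "t \<in> (\<Union>i\<in>J. {t \<in> Q. \<exists>a\<in>{u t, v t}. \<exists>b\<in>{u t, v t}. h a i \<noteq> h b i})"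
    if "t \<in> Q" for t
  proof -
    have F': "u t \<in> F" "v t \<in> F" using uv[OF that] by auto
    then have "h (u t) \<noteq> h (v t)" using hinj neq[OF that] by (auto dest: inj_onD)
    moreover have "h (u t) \<in> extensional I" "h (v t) \<in> extensional I"
      using F' hC C' by (auto simp: PiE_def)
    ultimately obtain i where "i \<in> I" "h (u t) i \<noteq> h (v t) i"
      by (meson extensionalityI)
    then show ?thesis using outside[OF that] that by auto
  qed
  ultimately show ?thesis by (meson countable_subset subsetI)
qed

text \<open>The indices \<open>s \<in> P\<close> name the blocks of the line, the points \<open>u s t\<close>, \<open>v s t\<close> are the two ends of
  the jump at \<open>t \<in> Q\<close>, and the countable set \<open>D s\<close> comes arbitrarily close to all of these. Since \<open>P\<close> is
  uncountable, one block is mapped to a single point, and the fibre of that point has too many jumps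
  to be Corson.\<close>

theorem (in strictly_ordered_set) not_corson_to_one_preimage:
  assumes X: "compact_space (order_topology_on S r)"
    and P: "uncountable P" and BS: "\<And>s. s \<in> P \<Longrightarrow> B s \<subseteq> S" and sep: "separated P B"
    and Q: "uncountable Q"
    and D: "\<And>s. s \<in> P \<Longrightarrow> countable (D s)" "\<And>s. s \<in> P \<Longrightarrow> D s \<subseteq> B s"
    and uv: "\<And>s t. \<lbrakk>s \<in> P; t \<in> Q\<rbrakk> \<Longrightarrow>
        {u s t, v s t} \<subseteq> B s \<inter> (order_topology_on S r closure_of D s)"
    and neq: "\<And>s t. \<lbrakk>s \<in> P; t \<in> Q\<rbrakk> \<Longrightarrow> u s t \<noteq> v s t"
    and sepQ: "\<And>s. s \<in> P \<Longrightarrow> separated Q (\<lambda>t. {u s t, v s t})"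
  shows "\<not> corson_to_one_preimage (order_topology_on S r) M"
proof
  let ?X = "order_topology_on S r"
  assume "corson_to_one_preimage ?X M"
  then obtain f where M: "metrizable_space M" and f: "continuous_map ?X M f"
    and corson: "\<And>x. x \<in> topspace M \<Longrightarrow> corson_compact (subtopology ?X {y \<in> topspace ?X. f y = x})"
    unfolding corson_to_one_preimage_def by blast
  have "countable {s \<in> P. \<exists>a\<in>B s. \<exists>b\<in>B s. f a \<noteq> f b}"
    using X f M BS sep
    by (intro countable_nonconstant_blocks[of S M]) (auto simp: compact_space_def continuous_map_from_subtopology)
  then have "\<not> P \<subseteq> {s \<in> P. \<exists>a\<in>B s. \<exists>b\<in>B s. f a \<noteq> f b}" using P countable_subset by blast
  then obtain s where s: "s \<in> P" "\<And>a b. \<lbrakk>a \<in> B s; b \<in> B s\<rbrakk> \<Longrightarrow> f a = f b" by blast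
  obtain t where "t \<in> Q" using Q by fastforce
  define x where "x = f (u s t)"
  define F where "F = {y \<in> topspace ?X. f y = x}"
  have x: "x \<in> topspace M"
    using f uv[OF s(1) \<open>t \<in> Q\<close>] BS[OF s(1)] unfolding x_def continuous_map_def by auto
  have BF: "B s \<subseteq> F" using s uv[OF s(1) \<open>t \<in> Q\<close>] BS[OF s(1)] unfolding F_def x_def by auto
  have "closedin ?X {y \<in> topspace ?X. f y \<in> {x}}"
    using f x metrizable_imp_Hausdorff_space[OF M]
    by (intro closedin_continuous_map_preimage) (auto intro: closedin_Hausdorff_singleton)
  then have "compactin ?X F" using X unfolding F_def by (simp add: closedin_compact_space)
  moreover have "corson_compact (subtopology ?X F)" using corson[OF x] by (simp add: F_def)
  ultimately have "countable Q"
    by (rule corson_countable_jumps[of F "D s" Q "u s" "v s"])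
      (use D[OF s(1)] uv[OF s(1)] neq[OF s(1)] sepQ[OF s(1)] BF in blast)+
  then show False using Q by blast
qed

section \<open>Lexicographic products of two orders\<close>

lemma strictly_ordered_set_less: "strictly_ordered_set A {(a, b :: 'a :: linorder). a < b}"
  by unfold_locales auto

lemma strictly_ordered_set_lex_prod:
  assumes "strictly_ordered_set A ra" "strictly_ordered_set B rb"
  shows "strictly_ordered_set (A \<times> B) (ra <*lex*> rb)"
proof -
  interpret a: strictly_ordered_set A ra by fact
  interpret b: strictly_ordered_set B rb by fact
  show ?thesis
  proof
    fix x y z assume xyz: "x \<in> A \<times> B" "y \<in> A \<times> B" "z \<in> A \<times> B"
      and less: "(x, y) \<in> ra <*lex*> rb" "(y, z) \<in> ra <*lex*> rb"
    show "(x, z) \<in> ra <*lex*> rb"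
      using xyz less a.trans[of "fst x" "fst y" "fst z"] b.trans[of "snd x" "snd y" "snd z"]
      by (cases x; cases y; cases z) auto
  next
    fix x assume "x \<in> A \<times> B"
    then show "(x, x) \<notin> ra <*lex*> rb"
      using a.irrefl[of "fst x"] b.irrefl[of "snd x"] by (cases x) simp
  next
    fix x y assume "x \<in> A \<times> B" "y \<in> A \<times> B" "x \<noteq> y"
    then show "(x, y) \<in> ra <*lex*> rb \<or> (y, x) \<in> ra <*lex*> rb"
      using a.total[of "fst x" "fst y"] b.total[of "snd x" "snd y"] by (cases x; cases y) auto
  qed
qed

text \<open>The supremum of \<open>E\<close> is \<open>(s, t)\<close>, where \<open>s\<close> is the supremum of the first coordinates and \<open>t\<close>
  that of the section of \<open>E\<close> at \<open>s\<close>. If \<open>s\<close> is not attained, then the section is empty and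
  \<open>t\<close> is the least element, as it should be.\<close>

lemma order_complete_lex_prod:
  assumes A: "order_complete A ra" and B: "order_complete B rb"
  shows "order_complete (A \<times> B) (ra <*lex*> rb)"
  unfolding order_complete_def
proof (intro allI impI)
  fix E assume E: "E \<subseteq> A \<times> B"
  then have "fst ` E \<subseteq> A" by auto
  then obtain s where s: "s \<in> A" "\<forall>a\<in>fst ` E. (s, a) \<notin> ra"
      "\<forall>b\<in>A. (b, s) \<in> ra \<longrightarrow> (\<exists>a\<in>fst ` E. (b, a) \<in> ra)"
    by (rule order_completeD[OF A])
  have "{b. (s, b) \<in> E} \<subseteq> B" using E by auto
  then obtain t where t: "t \<in> B" "\<forall>a\<in>{b. (s, b) \<in> E}. (t, a) \<notin> rb"
      "\<forall>b\<in>B. (b, t) \<in> rb \<longrightarrow> (\<exists>a\<in>{b. (s, b) \<in> E}. (b, a) \<in> rb)"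
    by (rule order_completeD[OF B])
  show "\<exists>s\<in>A \<times> B. (\<forall>a\<in>E. (s, a) \<notin> ra <*lex*> rb) \<and>
      (\<forall>b\<in>A \<times> B. (b, s) \<in> ra <*lex*> rb \<longrightarrow> (\<exists>a\<in>E. (b, a) \<in> ra <*lex*> rb))"
  proof (rule bexI[of _ "(s, t)"], intro conjI ballI impI)
    fix e assume "e \<in> E"
    then show "((s, t), e) \<notin> ra <*lex*> rb"
      using s(2) t(2) by (cases e) force
  next
    fix b assume "b \<in> A \<times> B" "(b, (s, t)) \<in> ra <*lex*> rb"
    then show "\<exists>a\<in>E. (b, a) \<in> ra <*lex*> rb"
      using s(3) t(3) by (cases b) force
  qed (use s t in auto)
qed

lemma order_complete_unit_interval: "order_complete {0..1::real} {(a, b). a < b}"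
  unfolding order_complete_def
proof (intro allI impI)
  fix A :: "real set" assume A: "A \<subseteq> {0..1}"
  show "\<exists>s\<in>{0..1}. (\<forall>a\<in>A. (s, a) \<notin> {(a, b). a < b}) \<and>
      (\<forall>b\<in>{0..1}. (b, s) \<in> {(a, b). a < b} \<longrightarrow> (\<exists>a\<in>A. (b, a) \<in> {(a, b). a < b}))"
  proof (cases "A = {}")
    case True
    then show ?thesis by (intro bexI[of _ 0]) auto
  next
    case False
    have bdd: "bdd_above A" using A by (meson bdd_above_Icc bdd_above_mono)
    have "Sup A \<in> {0..1}"
      using A False bdd by (metis atLeastAtMost_iff cSup_least cSup_upper2 ex_in_conv subsetD)
    moreover have "\<exists>a\<in>A. b < a" if "b < Sup A" for b
      using that less_cSup_iff[OF False bdd] by blast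
    ultimately show ?thesis
      using bdd by (intro bexI[of _ "Sup A"]) (auto simp: not_less intro: cSup_upper)
  qed
qed

lemma order_complete_two: "order_complete {0, 1::nat} {(a, b). a < b}"
  unfolding order_complete_def
proof (intro allI impI)
  fix A :: "nat set" assume "A \<subseteq> {0, 1}"
  then show "\<exists>s\<in>{0, 1}. (\<forall>a\<in>A. (s, a) \<notin> {(a, b). a < b}) \<and>
      (\<forall>b\<in>{0, 1}. (b, s) \<in> {(a, b). a < b} \<longrightarrow> (\<exists>a\<in>A. (b, a) \<in> {(a, b). a < b}))"
    by (intro bexI[of _ "if 1 \<in> A then 1 else 0"]) (auto split: if_splits)
qed

section \<open>Lexicographic powers over a well-ordered index set\<close>

lemma lex_fun_relI:
  assumes "i \<in> I" "x i < y i" "\<And>j. \<lbrakk>j \<in> I; (j, i) \<in> r\<rbrakk> \<Longrightarrow> x j = y j"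
  shows "(x, y) \<in> lex_fun_rel I r"
  using assms unfolding lex_fun_rel_def by blast

lemma lex_fun_relE:
  assumes "(x, y) \<in> lex_fun_rel I r"
  obtains i where "i \<in> I" "x i < y i" "\<And>j. \<lbrakk>j \<in> I; (j, i) \<in> r\<rbrakk> \<Longrightarrow> x j = y j"
  using assms unfolding lex_fun_rel_def by blast

lemma first_difference:
  assumes "wf r" "x \<in> extensional I" "y \<in> extensional I" "x \<noteq> y"
  obtains i where "i \<in> I" "x i \<noteq> y i" "\<And>j. \<lbrakk>j \<in> I; (j, i) \<in> r\<rbrakk> \<Longrightarrow> x j = y j"
proof -
  obtain k where "k \<in> {i \<in> I. x i \<noteq> y i}"
    using assms(2-4) by (metis (mono_tags, lifting) extensionalityI mem_Collect_eq)
  then obtain i where "i \<in> {i \<in> I. x i \<noteq> y i}"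
      "\<And>j. (j, i) \<in> r \<Longrightarrow> j \<notin> {i \<in> I. x i \<noteq> y i}"
    by (rule wfE_min[OF assms(1)]) blast
  then show thesis using that by blast
qed

lemma strictly_ordered_set_lex_fun:
  fixes A :: "'b::linorder set"
  assumes wf: "wf r" and tr: "trans r" and tot: "total r"
  shows "strictly_ordered_set (I \<rightarrow>\<^sub>E A) (lex_fun_rel I r)"
proof
  show "(x, x) \<notin> lex_fun_rel I r" for x :: "'a \<Rightarrow> 'b" by (auto simp: lex_fun_rel_def)
next
  fix x y z :: "'a \<Rightarrow> 'b"
  assume xy: "(x, y) \<in> lex_fun_rel I r" and yz: "(y, z) \<in> lex_fun_rel I r"
  obtain i where i: "i \<in> I" "x i < y i" "\<And>j. \<lbrakk>j \<in> I; (j, i) \<in> r\<rbrakk> \<Longrightarrow> x j = y j"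
    using xy by (rule lex_fun_relE) blast
  obtain k where k: "k \<in> I" "y k < z k" "\<And>j. \<lbrakk>j \<in> I; (j, k) \<in> r\<rbrakk> \<Longrightarrow> y j = z j"
    using yz by (rule lex_fun_relE) blast
  consider "i = k" | "(i, k) \<in> r" | "(k, i) \<in> r" using tot unfolding total_on_def by blast
  then show "(x, z) \<in> lex_fun_rel I r"
  proof cases
    case 1
    then show ?thesis using i k by (intro lex_fun_relI[of i]) auto
  next
    case 2
    then have "x j = z j" if "j \<in> I" "(j, i) \<in> r" for j
      using i(3)[OF that] k(3)[OF that(1)] transD[OF tr that(2)] by simp
    then show ?thesis using i k(3)[OF i(1) 2] by (intro lex_fun_relI[of i]) auto
  next
    case 3
    then have "x j = z j" if "j \<in> I" "(j, k) \<in> r" for j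
      using k(3)[OF that] i(3)[OF that(1)] transD[OF tr that(2)] by simp
    then show ?thesis using k i(3)[OF k(1) 3] by (intro lex_fun_relI[of k]) auto
  qed
next
  fix x y assume xy: "x \<in> I \<rightarrow>\<^sub>E A" "y \<in> I \<rightarrow>\<^sub>E A" "x \<noteq> y"
  then have "x \<in> extensional I" "y \<in> extensional I" by (auto simp: PiE_def)
  then obtain i where i: "i \<in> I" "x i \<noteq> y i" "\<And>j. \<lbrakk>j \<in> I; (j, i) \<in> r\<rbrakk> \<Longrightarrow> x j = y j"
    using xy(3) by (rule first_difference[OF wf]) blast
  from i(2) show "(x, y) \<in> lex_fun_rel I r \<or> (y, x) \<in> lex_fun_rel I r"
  proof (rule neqE)
    assume "x i < y i"
    then show ?thesis using i by (intro disjI1 lex_fun_relI[of i]) auto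
  next
    assume "y i < x i"
    then show ?thesis using i by (intro disjI2 lex_fun_relI[of i]) auto
  qed
qed

text \<open>The supremum \<open>s\<close> is found by recursion along the index set: \<open>s i = 1\<close> iff an element of \<open>A\<close> that
  agrees with \<open>s\<close> before \<open>i\<close> has the value \<open>1\<close> at \<open>i\<close>. A point below \<open>s\<close> has value \<open>0\<close> where it first
  differs from \<open>s\<close>, and the element of \<open>A\<close> that caused \<open>s i = 1\<close> at this place is above it; an element
  of \<open>A\<close> above \<open>s\<close> would have forced the value \<open>1\<close> where it first differs.\<close>

lemma order_complete_lex_fun:
  assumes wf: "wf r"
  shows "order_complete (I \<rightarrow>\<^sub>E {0, 1::nat}) (lex_fun_rel I r)"
  unfolding order_complete_def
proof (intro allI impI)
  fix A assume A: "A \<subseteq> I \<rightarrow>\<^sub>E {0, 1::nat}"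
  define H where
    "H g i = (if \<exists>x\<in>A. (\<forall>j\<in>I. (j, i) \<in> r \<longrightarrow> x j = g j) \<and> x i = 1 then 1 else 0 :: nat)" for g i
  define s where "s = restrict (wfrec r H) I"
  have H_cong: "H g i = H g' i" if "\<And>j. \<lbrakk>j \<in> I; (j, i) \<in> r\<rbrakk> \<Longrightarrow> g j = g' j" for g g' i
  proof -
    have "(\<forall>j\<in>I. (j, i) \<in> r \<longrightarrow> x j = g j) \<longleftrightarrow> (\<forall>j\<in>I. (j, i) \<in> r \<longrightarrow> x j = g' j)" for x
      using that by auto
    then show ?thesis by (simp only: H_def)
  qed
  have s: "s i = (if \<exists>x\<in>A. (\<forall>j\<in>I. (j, i) \<in> r \<longrightarrow> x j = s j) \<and> x i = 1 then 1 else 0)"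
    if "i \<in> I" for i
  proof -
    have "s i = H (cut (wfrec r H) r i) i" using that wfrec[OF wf, of H i] by (simp add: s_def)
    also have "\<dots> = H s i" by (rule H_cong) (simp add: s_def cut_apply)
    finally show ?thesis unfolding H_def .
  qed
  show "\<exists>s\<in>I \<rightarrow>\<^sub>E {0, 1}. (\<forall>a\<in>A. (s, a) \<notin> lex_fun_rel I r) \<and>
      (\<forall>b\<in>I \<rightarrow>\<^sub>E {0, 1}. (b, s) \<in> lex_fun_rel I r \<longrightarrow> (\<exists>a\<in>A. (b, a) \<in> lex_fun_rel I r))"
  proof (rule bexI[of _ s], intro conjI ballI impI notI)
    have "s i \<in> {0, 1}" if "i \<in> I" for i using s[OF that] by simp
    then show "s \<in> I \<rightarrow>\<^sub>E {0, 1}" by (simp add: PiE_iff) (simp add: s_def)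
  next
    fix a assume a: "a \<in> A" "(s, a) \<in> lex_fun_rel I r"
    obtain i where i: "i \<in> I" "s i < a i" "\<And>j. \<lbrakk>j \<in> I; (j, i) \<in> r\<rbrakk> \<Longrightarrow> s j = a j"
      using a(2) by (rule lex_fun_relE) blast
    have "a i \<in> {0, 1}" using A a(1) i(1) by (auto simp: PiE_iff)
    then have "a i = 1" using i(2) by auto
    then have "s i = 1" using s[OF i(1)] a(1) i(3) by auto
    then show False using i(2) \<open>a i = 1\<close> by simp
  next
    fix b assume b: "(b, s) \<in> lex_fun_rel I r"
    obtain i where i: "i \<in> I" "b i < s i" "\<And>j. \<lbrakk>j \<in> I; (j, i) \<in> r\<rbrakk> \<Longrightarrow> b j = s j"
      using b by (rule lex_fun_relE) blast
    then have "s i \<noteq> 0" by simp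
    then obtain x where x: "x \<in> A" "\<forall>j\<in>I. (j, i) \<in> r \<longrightarrow> x j = s j" "x i = 1"
      using s[OF i(1)] by (metis (no_types, lifting))
    have "b i < x i" using i(2) s[OF i(1)] x(3) by (simp split: if_splits)
    then have "(b, x) \<in> lex_fun_rel I r"
      using i x by (intro lex_fun_relI[of i]) auto
    then show "\<exists>a\<in>A. (b, a) \<in> lex_fun_rel I r" using x(1) by blast
  qed
qed

section \<open>The split square\<close>

abbreviation square_carrier :: "(real \<times> real \<times> nat) set" where
  "square_carrier \<equiv> {0..1} \<times> {0..1} \<times> {0, 1}"

abbreviation square_less :: "((real \<times> real \<times> nat) \<times> (real \<times> real \<times> nat)) set" where
  "square_less \<equiv> {(a, b). a < b} <*lex*> {(a, b). a < b} <*lex*> {(a, b). a < b}"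

lemma strictly_ordered_set_square: "strictly_ordered_set square_carrier square_less"
  by (intro strictly_ordered_set_lex_prod strictly_ordered_set_less)

lemma compact_space_square: "compact_space (order_topology_on square_carrier square_less)"
  by (intro strictly_ordered_set.compact_space_order_topology strictly_ordered_set_square
      order_complete_lex_prod order_complete_unit_interval order_complete_two)

text \<open>A jump at \<open>t\<close> is approximated from outside: the point \<open>(s, t, 0)\<close> by points with rational second
  coordinate \<open>q < t\<close>, the point \<open>(s, t, 1)\<close> by those with \<open>q > t\<close>.\<close>

lemma square_split_pair_in_closure:
  assumes s: "s \<in> {0..1}" and t: "t \<in> {0<..<1}"
  defines "D \<equiv> {s} \<times> (\<rat> \<inter> {0..1}) \<times> {0, 1}"
  shows "(s, t, 0) \<in> order_topology_on square_carrier square_less closure_of D"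
    and "(s, t, 1) \<in> order_topology_on square_carrier square_less closure_of D"
proof -
  interpret strictly_ordered_set square_carrier square_less by (rule strictly_ordered_set_square)
  show "(s, t, 0) \<in> order_topology_on square_carrier square_less closure_of D"
  proof (rule closure_of_from_below[of _ "(s, 0, 0)"])
    fix a assume a: "a \<in> square_carrier" "(a, (s, t, 0)) \<in> square_less"
    obtain x y e where xye: "a = (x, y, e)" by (cases a) auto
    (* if a lies in an earlier block, then any q below t in the present block will do *)
    have "(if x = s then y else 0) < t" using a t by (auto simp: xye)
    then obtain q where q: "q \<in> \<rat>" "(if x = s then y else 0) < q" "q < t"
      using Rats_dense_in_real by blast
    then have "(s, q, 0) \<in> D" "(a, (s, q, 0)) \<in> square_less"
      using a t by (auto simp: xye D_def split: if_splits)
    then show "\<exists>d\<in>D. (a, d) \<in> square_less \<and> (d = (s, t, 0) \<or> (d, (s, t, 0)) \<in> square_less)"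
      using q(3) by (intro bexI[of _ "(s, q, 0)"]) auto
  qed (use s t in \<open>auto simp: D_def\<close>)
  show "(s, t, 1) \<in> order_topology_on square_carrier square_less closure_of D"
  proof (rule closure_of_from_above[of _ "(s, 1, 1)"])
    fix a assume a: "a \<in> square_carrier" "((s, t, 1), a) \<in> square_less"
    obtain x y e where xye: "a = (x, y, e)" by (cases a) auto
    have "t < (if x = s then y else 1)" using a t by (auto simp: xye)
    then obtain q where q: "q \<in> \<rat>" "t < q" "q < (if x = s then y else 1)"
      using Rats_dense_in_real by blast
    then have "(s, q, 1) \<in> D" "((s, q, 1), a) \<in> square_less"
      using a t by (auto simp: xye D_def split: if_splits)
    then show "\<exists>d\<in>D. (d, a) \<in> square_less \<and> (d = (s, t, 1) \<or> ((s, t, 1), d) \<in> square_less)"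
      using q(2) by (intro bexI[of _ "(s, q, 1)"]) auto
  qed (use s t in \<open>auto simp: D_def\<close>)
qed

lemma square_not_corson_to_one_preimage:
  "\<not> corson_to_one_preimage (order_topology_on square_carrier square_less) M"
proof -
  interpret strictly_ordered_set square_carrier square_less by (rule strictly_ordered_set_square)
  show ?thesis
  proof (rule not_corson_to_one_preimage[where P = "{0..1}" and Q = "{0<..<1}"
        and B = "\<lambda>s. {s} \<times> {0..1} \<times> {0, 1}" and D = "\<lambda>s. {s} \<times> (\<rat> \<inter> {0..1}) \<times> {0, 1}"
        and u = "\<lambda>s t. (s, t, 0)" and v = "\<lambda>s t. (s, t, 1)", OF compact_space_square])
    show "uncountable {0..1::real}" "uncountable {0<..<1::real}"
      by (simp_all add: uncountable_closed_interval uncountable_open_interval)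
    show "separated {0..1} (\<lambda>s. {s} \<times> {0..1} \<times> {0, 1})"
      by (rule separatedI[of _ "(<)"]) auto
    show "separated {0<..<1} (\<lambda>t. {(s, t, 0), (s, t, 1)})" for s
      by (rule separatedI[of _ "(<)"]) auto
    show "countable ({s} \<times> (\<rat> \<inter> {0..1::real}) \<times> {0, 1::nat})" for s :: real
      by (intro countable_SIGMA countable_Int1 countable_rat) auto
    show "{(s, t, 0), (s, t, 1)} \<subseteq> {s} \<times> {0..1} \<times> {0, 1} \<inter>
        (order_topology_on square_carrier square_less closure_of ({s} \<times> (\<rat> \<inter> {0..1}) \<times> {0, 1}))"
      if "s \<in> {0..1}" "t \<in> {0<..<1}" for s t
      using square_split_pair_in_closure[OF that] that by simp
  qed auto
qed

section \<open>The lexicographic power of the two-point set\<close>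

abbreviation cantor_carrier :: "(nat \<times> nat \<Rightarrow> nat) set" where
  "cantor_carrier \<equiv> omega2_plus1 \<rightarrow>\<^sub>E {0, 1}"

abbreviation cantor_less :: "((nat \<times> nat \<Rightarrow> nat) \<times> (nat \<times> nat \<Rightarrow> nat)) set" where
  "cantor_less \<equiv> lex_fun_rel omega2_plus1 omega_sq_less"

lemma omega_sq_less_wellorder: "wf omega_sq_less" "trans omega_sq_less" "total omega_sq_less"
  unfolding omega_sq_less_def by (auto simp: total_on_def)

lemma strictly_ordered_set_cantor: "strictly_ordered_set cantor_carrier cantor_less"
  by (intro strictly_ordered_set_lex_fun omega_sq_less_wellorder)

lemma compact_space_cantor: "compact_space (order_topology_on cantor_carrier cantor_less)"
  by (intro strictly_ordered_set.compact_space_order_topology strictly_ordered_set_cantor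
      order_complete_lex_fun omega_sq_less_wellorder)

text \<open>The lexicographic order of the characteristic functions.\<close>

definition set_less :: "nat set \<Rightarrow> nat set \<Rightarrow> bool" where
  "set_less s t \<longleftrightarrow> (\<exists>n. n \<notin> s \<and> n \<in> t \<and> (\<forall>k<n. k \<in> s \<longleftrightarrow> k \<in> t))"

lemma set_less_total: "s \<noteq> t \<Longrightarrow> set_less s t \<or> set_less t s"
proof -
  assume "s \<noteq> t"
  then obtain k where "k \<in> s \<longleftrightarrow> k \<notin> t" by blast
  then have "\<exists>n. (n \<in> s \<longleftrightarrow> n \<notin> t) \<and> (\<forall>k<n. \<not> (k \<in> s \<longleftrightarrow> k \<notin> t))"
    by (rule exists_least_iff[THEN iffD1, OF exI])
  then show ?thesis unfolding set_less_def by blast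
qed

text \<open>Coordinates that exhibit the power as a lexicographic product of two Cantor sets, given as
  families of sets of natural numbers, and a two-point set.\<close>

definition cantor_point :: "nat set \<Rightarrow> nat set \<Rightarrow> nat \<Rightarrow> nat \<times> nat \<Rightarrow> nat" where
  "cantor_point s t e =
     (\<lambda>p\<in>omega2_plus1.
        if fst p = 0 then of_bool (snd p \<in> s)
        else if fst p = 1 then of_bool (snd p \<in> t) else e)"

lemma cantor_point_in_carrier: "e \<in> {0, 1} \<Longrightarrow> cantor_point s t e \<in> cantor_carrier"
  by (auto simp: cantor_point_def PiE_iff)

lemma cantor_points_subset_carrier:
  "(\<lambda>(t, e). cantor_point s t e) ` (W \<times> {0, 1}) \<subseteq> cantor_carrier"
proof (rule image_subsetI)
  fix p assume "p \<in> W \<times> {0, 1 :: nat}"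
  then have "snd p \<in> {0, 1}" by (simp add: mem_Times_iff)
  then have "cantor_point s (fst p) (snd p) \<in> cantor_carrier" by (rule cantor_point_in_carrier)
  then show "(case p of (t, e) \<Rightarrow> cantor_point s t e) \<in> cantor_carrier"
    by (simp only: case_prod_beta)
qed

lemma cantor_point_less_first:
  assumes "set_less s s'"
  shows "(cantor_point s t e, cantor_point s' t' e') \<in> cantor_less"
proof -
  obtain n where "n \<notin> s" "n \<in> s'" "\<forall>k<n. k \<in> s \<longleftrightarrow> k \<in> s'"
    using assms unfolding set_less_def by blast
  then show ?thesis
    by (intro lex_fun_relI[of "(0, n)"])
      (auto simp: cantor_point_def omega2_plus1_eq omega_sq_less_def)
qed

lemma cantor_point_less_second:
  assumes "set_less t t'"
  shows "(cantor_point s t e, cantor_point s t' e') \<in> cantor_less"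
proof -
  obtain n where "n \<notin> t" "n \<in> t'" "\<forall>k<n. k \<in> t \<longleftrightarrow> k \<in> t'"
    using assms unfolding set_less_def by blast
  then show ?thesis
    by (intro lex_fun_relI[of "(1, n)"])
      (auto simp: cantor_point_def omega2_plus1_eq omega_sq_less_def)
qed

text \<open>The entries up to an index other than the last one involve only an initial segment of \<open>t\<close>. So if a point differs
  from \<open>cantor_point s t e'\<close> first at such an index, changing \<open>t\<close> far enough out does not affect the
  comparison with that point.\<close>

lemma cantor_point_agrees_up_to:
  assumes "i \<in> omega2_plus1" "i \<noteq> (2, 0)"
  obtains n where
    "\<And>w e j. \<lbrakk>\<forall>k\<le>n. k \<in> w \<longleftrightarrow> k \<in> t; j \<in> omega2_plus1; j = i \<or> (j, i) \<in> omega_sq_less\<rbrakk>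
       \<Longrightarrow> cantor_point s w e j = cantor_point s t e' j"
proof (rule that[of "snd i"])
  fix w e j
  assume "\<forall>k\<le>snd i. k \<in> w \<longleftrightarrow> k \<in> t" "j \<in> omega2_plus1" "j = i \<or> (j, i) \<in> omega_sq_less"
  then show "cantor_point s w e j = cantor_point s t e' j"
    using assms by (cases i; cases j) (auto simp: cantor_point_def omega2_plus1_eq omega_sq_less_def)
qed

text \<open>If \<open>t\<close> is infinite, then it is approximated from below by finite sets, and if its complement
  is infinite, then from above. This makes both ends of the jump at \<open>t\<close> limits of points that
  have a finite set in the place of \<open>t\<close>.\<close>

definition split_index :: "nat set set" where
  "split_index = {t. infinite t \<and> infinite (- t)}"

lemma uncountable_nat_sets: "uncountable (UNIV :: nat set set)"
proof
  assume "countable (UNIV :: nat set set)"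
  then have "range (from_nat_into (UNIV :: nat set set)) = Pow UNIV"
    by (simp add: range_from_nat_into)
  then show False using Cantors_theorem[of "UNIV :: nat set"] by blast
qed

lemma uncountable_split_index: "uncountable split_index"
proof
  assume "countable split_index"
  moreover have fin: "countable (Collect (finite :: nat set \<Rightarrow> bool))"
    by (rule countable_Collect_finite)
  moreover have "countable (uminus ` Collect (finite :: nat set \<Rightarrow> bool))"
    using fin by (rule countable_image)
  ultimately have "countable (split_index \<union> Collect finite \<union> uminus ` Collect finite)"
    by (intro countable_Un)
  moreover have "split_index \<union> Collect finite \<union> uminus ` Collect finite = UNIV"
  proof (intro equalityI subsetI UNIV_I)
    fix t :: "nat set"
    have "t \<in> uminus ` Collect finite" if "finite (- t)"
      using that by (intro image_eqI[of _ _ "- t"]) simp_all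
    then show "t \<in> split_index \<union> Collect finite \<union> uminus ` Collect finite"
      unfolding split_index_def by blast
  qed
  ultimately show False using uncountable_nat_sets by simp
qed

text \<open>Truncations \<open>t \<inter> {..<l}\<close> with \<open>l \<in> t\<close> approximate \<open>t\<close> from below, and the sets
  \<open>insert l (t \<inter> {..<l})\<close> with \<open>l \<notin> t\<close> from above. All of these are finite, so countably many points
  suffice. A point below the lower end or above the upper end first differs from it before the
  last index, since there the lower end has \<open>0\<close>, the least value, and the upper end has \<open>1\<close>, the greatest.\<close>

lemma cantor_split_pair_in_closure:
  fixes s :: "nat set"
  assumes t: "t \<in> split_index"
  defines "D \<equiv> (\<lambda>(w, e). cantor_point s w e) ` (Collect finite \<times> {0, 1})"
  shows "cantor_point s t 0 \<in> order_topology_on cantor_carrier cantor_less closure_of D"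
    and "cantor_point s t 1 \<in> order_topology_on cantor_carrier cantor_less closure_of D"
proof -
  interpret strictly_ordered_set cantor_carrier cantor_less by (rule strictly_ordered_set_cantor)
  have DS: "D \<subseteq> cantor_carrier" unfolding D_def by (rule cantor_points_subset_carrier)
  have inD: "cantor_point s w e \<in> D" if "finite w" "e \<in> {0, 1}" for w e
    using that by (force simp: D_def)
  have above: "\<exists>m>n. m \<in> t" and gap: "\<exists>m>n. m \<notin> t" for n
    using t by (auto simp: split_index_def infinite_nat_iff_unbounded)
  have below_less: "set_less (t \<inter> {..<m}) t" if "m \<in> t" for m
    unfolding set_less_def using that by (intro exI[of _ m]) auto
  have less_above: "set_less t (insert m (t \<inter> {..<m}))" if "m \<notin> t" for m
    unfolding set_less_def using that by (intro exI[of _ m]) auto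
  obtain m where m: "m \<in> t" using above by blast
  obtain m' where m': "m' \<notin> t" using gap by blast
  show "cantor_point s t 0 \<in> order_topology_on cantor_carrier cantor_less closure_of D"
  proof (rule closure_of_from_below[OF _ _ _ DS])
    show "(cantor_point s (t \<inter> {..<m}) 0, cantor_point s t 0) \<in> cantor_less"
      using below_less[OF m] by (rule cantor_point_less_second)
    show "cantor_point s (t \<inter> {..<m}) 0 \<in> cantor_carrier"
      by (rule cantor_point_in_carrier) simp
    fix a assume "(a, cantor_point s t 0) \<in> cantor_less"
    then obtain i where i: "i \<in> omega2_plus1" "a i < cantor_point s t 0 i"
        "\<And>j. \<lbrakk>j \<in> omega2_plus1; (j, i) \<in> omega_sq_less\<rbrakk> \<Longrightarrow> a j = cantor_point s t 0 j"
      by (rule lex_fun_relE) blast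
    have "i \<noteq> (2, 0)" using i(2) by (auto simp: cantor_point_def omega2_plus1_eq)
    then obtain n where n: "\<And>w e j. \<lbrakk>\<forall>k\<le>n. k \<in> w \<longleftrightarrow> k \<in> t; j \<in> omega2_plus1;
        j = i \<or> (j, i) \<in> omega_sq_less\<rbrakk> \<Longrightarrow> cantor_point s w e j = cantor_point s t 0 j"
      using cantor_point_agrees_up_to[OF i(1), of t s 0] by blast
    obtain l where l: "n < l" "l \<in> t" using above by blast
    let ?d = "cantor_point s (t \<inter> {..<l}) 0"
    have agree: "?d j = cantor_point s t 0 j"
      if "j \<in> omega2_plus1" "j = i \<or> (j, i) \<in> omega_sq_less" for j
      using l that by (intro n) auto
    have "(a, ?d) \<in> cantor_less"
      using i agree by (intro lex_fun_relI[of i]) auto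
    moreover have "(?d, cantor_point s t 0) \<in> cantor_less"
      using below_less[OF l(2)] by (rule cantor_point_less_second)
    moreover have "?d \<in> D" by (rule inD) auto
    ultimately show "\<exists>d\<in>D. (a, d) \<in> cantor_less \<and>
        (d = cantor_point s t 0 \<or> (d, cantor_point s t 0) \<in> cantor_less)" by blast
  qed (rule cantor_point_in_carrier, simp)
  show "cantor_point s t 1 \<in> order_topology_on cantor_carrier cantor_less closure_of D"
  proof (rule closure_of_from_above[OF _ _ _ DS])
    show "(cantor_point s t 1, cantor_point s (insert m' (t \<inter> {..<m'})) 1) \<in> cantor_less"
      using less_above[OF m'] by (rule cantor_point_less_second)
    show "cantor_point s (insert m' (t \<inter> {..<m'})) 1 \<in> cantor_carrier"
      by (rule cantor_point_in_carrier) simp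
    fix a assume a: "a \<in> cantor_carrier" "(cantor_point s t 1, a) \<in> cantor_less"
    obtain i where i: "i \<in> omega2_plus1" "cantor_point s t 1 i < a i"
        "\<And>j. \<lbrakk>j \<in> omega2_plus1; (j, i) \<in> omega_sq_less\<rbrakk> \<Longrightarrow> cantor_point s t 1 j = a j"
      using a(2) by (rule lex_fun_relE) blast
    have "a i \<in> {0, 1}" using a(1) i(1) by (auto simp: PiE_iff)
    then have "i \<noteq> (2, 0)" using i(2) by (auto simp: cantor_point_def omega2_plus1_eq)
    then obtain n where n: "\<And>w e j. \<lbrakk>\<forall>k\<le>n. k \<in> w \<longleftrightarrow> k \<in> t; j \<in> omega2_plus1;
        j = i \<or> (j, i) \<in> omega_sq_less\<rbrakk> \<Longrightarrow> cantor_point s w e j = cantor_point s t 1 j"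
      using cantor_point_agrees_up_to[OF i(1), of t s 1] by blast
    obtain l where l: "n < l" "l \<notin> t" using gap by blast
    let ?d = "cantor_point s (insert l (t \<inter> {..<l})) 1"
    have agree: "?d j = cantor_point s t 1 j"
      if "j \<in> omega2_plus1" "j = i \<or> (j, i) \<in> omega_sq_less" for j
      using l that by (intro n) auto
    have "(?d, a) \<in> cantor_less"
      using i agree by (intro lex_fun_relI[of i]) auto
    moreover have "(cantor_point s t 1, ?d) \<in> cantor_less"
      using less_above[OF l(2)] by (rule cantor_point_less_second)
    moreover have "?d \<in> D" by (rule inD) auto
    ultimately show "\<exists>d\<in>D. (d, a) \<in> cantor_less \<and>
        (d = cantor_point s t 1 \<or> (cantor_point s t 1, d) \<in> cantor_less)" by blast
  qed (rule cantor_point_in_carrier, simp)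
qed

lemma cantor_not_corson_to_one_preimage:
  "\<not> corson_to_one_preimage (order_topology_on cantor_carrier cantor_less) M"
proof -
  interpret strictly_ordered_set cantor_carrier cantor_less by (rule strictly_ordered_set_cantor)
  define B where "B s = (\<lambda>(t, e). cantor_point s t e) ` (UNIV \<times> {0, 1})" for s
  define D where "D s = (\<lambda>(w, e). cantor_point s w e) ` (Collect finite \<times> {0, 1})" for s
  show ?thesis
  proof (rule not_corson_to_one_preimage[where P = UNIV and Q = split_index and B = B and D = D
        and u = "\<lambda>s t. cantor_point s t 0" and v = "\<lambda>s t. cantor_point s t 1",
        OF compact_space_cantor uncountable_nat_sets _ _ uncountable_split_index])
    show "B s \<subseteq> cantor_carrier" for s
      unfolding B_def by (rule cantor_points_subset_carrier)
    show "separated UNIV B"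
      by (rule separatedI[of _ set_less])
        (auto simp: B_def set_less_total intro: cantor_point_less_first)
    show "countable (D s)" for s
      unfolding D_def by (intro countable_image countable_SIGMA countable_Collect_finite) auto
    show "D s \<subseteq> B s" for s unfolding B_def D_def by (intro image_mono) auto
    show "{cantor_point s t 0, cantor_point s t 1} \<subseteq>
        B s \<inter> (order_topology_on cantor_carrier cantor_less closure_of D s)"
      if "t \<in> split_index" for s t
      using cantor_split_pair_in_closure[OF that, of s] by (auto simp: B_def D_def)
    have "cantor_point s t 0 (2, 0) \<noteq> cantor_point s t 1 (2, 0)" for s t
      by (simp add: cantor_point_def omega2_plus1_eq)
    then show "cantor_point s t 0 \<noteq> cantor_point s t 1" for s t by metis
    show "separated split_index (\<lambda>t. {cantor_point s t 0, cantor_point s t 1})" for s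
      by (rule separatedI[of _ set_less])
        (auto simp: set_less_total intro: cantor_point_less_second)
  qed
qed

theorem corollary8:
  shows "compact_space cantor_lex \<and>
         \<not> (\<exists>M :: 'm topology. compact_space M \<and> corson_to_one_preimage cantor_lex M) \<and>
         compact_space square_split_lex \<and>
         \<not> (\<exists>M :: 'm topology. compact_space M \<and> corson_to_one_preimage square_split_lex M)"
  unfolding cantor_lex_def square_split_lex_def
  using compact_space_cantor cantor_not_corson_to_one_preimage
    compact_space_square square_not_corson_to_one_preimage
  by blast

end
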